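(* For every vertex $s$ of $G$ we have the equality of formal power series \[\mathcal{B}(G,s;y)=\mathcal{P}(G,s;y)=(1-y)\,\mathcal{R}(G;y).\] Since the right-hand side is independent of $s$, the Biggs–Merino polynomial $\mathcal{B}(G,s;y)$ is independent of the choice of sink $s$ (conjecture of Perrot and Pham).
   Context: Let $G=(V,E)$ be a finite strongly connected digraph (loops and multiple edges allowed). Sinkless sandpile model: a chip configuration is $\mathbf{c}\in\mathbb{N}_0^V$; firing $v$ removes $\deg^+_G(v)$ chips from $v$ and sends one along each outgoing edge, legal if $\mathbf{c}(v)\ge\deg^+_G(v)$; $\mathbf{c}\rightsquigarrow\mathbf{d}$ means $\mathbf{d}$ is reached by finitely many legal firings. $\mathbf{c}$ is recurrent if unstable and $\mathbf{d}\rightsquigarrow\mathbf{c}$ whenever $\mathbf{c}\rightsquigarrow\mathbf{d}$; recurrent configurations are related by $\mathbf{c}\sim\mathbf{d}$ iff $\mathbf{c}\rightsquigarrow\mathbf{d}$. The level of a class is its number of chips; $\mathrm{Rec}_n(G,\sim)$ is the set of classes of level $n$ and $\mathcal{R}(G;y)=\sum_{n\ge0}|\mathrm{Rec}_n(G,\sim)|y^n$. Sandpile model with sink $s$: $s$-configurations $\widehat{\mathbf{c}}\in\mathbb{N}_0^{V\setminus\{s\}}$, $s$ never fires and chips sent to $s$ are lost; $\widehat{\mathbf{c}}^\circ$ is the stabilization; $\widehat{\mathbf{c}}$ is $s$-recurrent if for every $\widehat{\mathbf{c}}_1$ there is $\widehat{\mathbf{c}}_2$ with $(\widehat{\mathbf{c}}_1+\widehat{\mathbf{c}}_2)^\circ=\widehat{\mathbf{c}}$.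 With $\mathbf{u}_s(v)$ the number of edges $s\to v$, $\widehat{\mathbf{c}}\sim_s\widehat{\mathbf{d}}$ iff $\widehat{\mathbf{d}}=(\widehat{\mathbf{c}}+k\mathbf{u}_s)^\circ$ for some $k\in\mathbb{N}_0$; $\mathrm{Rec}(G,\sim_s)$ is the (finite) set of classes. Let $\overline{\mathbf{c}}$ extend $\widehat{\mathbf{c}}$ by $0$ at $s$, $\mathbf{1}_s$ the indicator of $s$, $\chi(\widehat{\mathbf{c}})$ the least $k$ with $\overline{\mathbf{c}}+k\mathbf{1}_s$ recurrent in the sinkless model, and $\mathrm{slvl}(\widehat{\mathbf{c}})=\chi(\widehat{\mathbf{c}})+\sum_{v\ne s}\widehat{\mathbf{c}}(v)$ (constant on classes); $\mathcal{P}(G,s;y)=\sum_{[\widehat{\mathbf{c}}]\in\mathrm{Rec}(G,\sim_s)}y^{\mathrm{slvl}([\widehat{\mathbf{c}}])}$. The d-level is $\mathrm{dlvl}(\widehat{\mathbf{c}})=\deg^+_G(s)+\sum_{v\ne s}\widehat{\mathbf{c}}(v)$, and of a class $\mathrm{dlvl}([\widehat{\mathbf{c}}])=\max_{\widehat{\mathbf{c}}'\in[\widehat{\mathbf{c}}]}\mathrm{dlvl}(\widehat{\mathbf{c}}')$. The Biggs–Merino polynomial is $\mathcal{B}(G,s;y)=\sum_{[\widehat{\mathbf{c}}]\in\mathrm{Rec}(G,\sim_s)}y^{\mathrm{dlvl}([\widehat{\mathbf{c}}])}$. *)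

theory Defs
  imports
    "Graph_Theory.Digraph_Component"
    "HOL-Computational_Algebra.Polynomial_FPS"
begin

text \<open>A configuration is a function on the whole vertex type that vanishes off the vertex set.
  Likewise, an \<open>s\<close>-configuration vanishes off the vertices other than \<open>s\<close>; so it is
  literally equal to its extension by \<open>0\<close> at \<open>s\<close>.\<close>

type_synonym 'a config = "'a \<Rightarrow> nat"

definition num_arcs :: "('a, 'b) pre_digraph \<Rightarrow> 'a \<Rightarrow> 'a \<Rightarrow> nat" where
  "num_arcs G v w = card {e \<in> arcs G. tail G e = v \<and> head G e = w}"

definition chips :: "('a, 'b) pre_digraph \<Rightarrow> 'a config \<Rightarrow> nat" where
  "chips G c = (\<Sum>v\<in>verts G. c v)"

text \<open>The subtraction is only ever used when the firing is legal, so it never truncates.\<close>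

definition fire :: "('a, 'b) pre_digraph \<Rightarrow> 'a \<Rightarrow> 'a config \<Rightarrow> 'a config" where
  "fire G v c = (\<lambda>w. c w - (if w = v then out_degree G v else 0) + num_arcs G v w)"


subsection \<open>The sinkless model\<close>

definition configs :: "('a, 'b) pre_digraph \<Rightarrow> 'a config set" where
  "configs G = {c. \<forall>v. v \<notin> verts G \<longrightarrow> c v = 0}"

definition fire_step :: "('a, 'b) pre_digraph \<Rightarrow> 'a config \<Rightarrow> 'a config \<Rightarrow> bool" where
  "fire_step G c d \<longleftrightarrow> (\<exists>v\<in>verts G. out_degree G v \<le> c v \<and> d = fire G v c)"

definition fires_to :: "('a, 'b) pre_digraph \<Rightarrow> 'a config \<Rightarrow> 'a config \<Rightarrow> bool" where
  "fires_to G = (fire_step G)\<^sup>*\<^sup>*"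

definition stable :: "('a, 'b) pre_digraph \<Rightarrow> 'a config \<Rightarrow> bool" where
  "stable G c \<longleftrightarrow> (\<forall>v\<in>verts G. c v < out_degree G v)"

definition recurrents :: "('a, 'b) pre_digraph \<Rightarrow> 'a config set" where
  "recurrents G =
    {c \<in> configs G. \<not> stable G c \<and> (\<forall>d. fires_to G c d \<longrightarrow> fires_to G d c)}"

definition rec_rel :: "('a, 'b) pre_digraph \<Rightarrow> ('a config \<times> 'a config) set" where
  "rec_rel G = {(c, d). c \<in> recurrents G \<and> d \<in> recurrents G \<and> fires_to G c d}"

text \<open>The number of chips is constant on each class, so its image of a class is a singleton.\<close>

definition level :: "('a, 'b) pre_digraph \<Rightarrow> 'a config set \<Rightarrow> nat" where
  "level G C = the_elem (chips G ` C)"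

definition rec_classes :: "('a, 'b) pre_digraph \<Rightarrow> nat \<Rightarrow> 'a config set set" where
  "rec_classes G n = {C \<in> recurrents G // rec_rel G. level G C = n}"

definition rec_series :: "('a, 'b) pre_digraph \<Rightarrow> int fps" where
  "rec_series G = Abs_fps (\<lambda>n. int (card (rec_classes G n)))"


subsection \<open>The model with sink \<open>s\<close>\<close>

definition sconfigs :: "('a, 'b) pre_digraph \<Rightarrow> 'a \<Rightarrow> 'a config set" where
  "sconfigs G s = {c. \<forall>v. v \<notin> verts G - {s} \<longrightarrow> c v = 0}"

definition sfire_step :: "('a, 'b) pre_digraph \<Rightarrow> 'a \<Rightarrow> 'a config \<Rightarrow> 'a config \<Rightarrow> bool" where
  "sfire_step G s c d \<longleftrightarrow>
    (\<exists>v\<in>verts G - {s}. out_degree G v \<le> c v \<and> d = (fire G v c)(s := 0))"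

definition sfires_to :: "('a, 'b) pre_digraph \<Rightarrow> 'a \<Rightarrow> 'a config \<Rightarrow> 'a config \<Rightarrow> bool" where
  "sfires_to G s = (sfire_step G s)\<^sup>*\<^sup>*"

definition sstable :: "('a, 'b) pre_digraph \<Rightarrow> 'a \<Rightarrow> 'a config \<Rightarrow> bool" where
  "sstable G s c \<longleftrightarrow> (\<forall>v\<in>verts G - {s}. c v < out_degree G v)"

definition stabilization :: "('a, 'b) pre_digraph \<Rightarrow> 'a \<Rightarrow> 'a config \<Rightarrow> 'a config" where
  "stabilization G s c = (THE d. sfires_to G s c d \<and> sstable G s d)"

definition srecurrents :: "('a, 'b) pre_digraph \<Rightarrow> 'a \<Rightarrow> 'a config set" where
  "srecurrents G s = {c \<in> sconfigs G s.
    \<forall>c1\<in>sconfigs G s. \<exists>c2\<in>sconfigs G s. stabilization G s (\<lambda>v. c1 v + c2 v) = c}"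

definition sink_config :: "('a, 'b) pre_digraph \<Rightarrow> 'a \<Rightarrow> 'a config" where
  "sink_config G s = (\<lambda>v. if v = s then 0 else num_arcs G s v)"

definition srec_rel :: "('a, 'b) pre_digraph \<Rightarrow> 'a \<Rightarrow> ('a config \<times> 'a config) set" where
  "srec_rel G s = {(c, d). c \<in> srecurrents G s \<and> d \<in> srecurrents G s \<and>
    (\<exists>k. d = stabilization G s (\<lambda>v. c v + k * sink_config G s v))}"

definition srec_classes :: "('a, 'b) pre_digraph \<Rightarrow> 'a \<Rightarrow> 'a config set set" where
  "srec_classes G s = srecurrents G s // srec_rel G s"

definition schips :: "('a, 'b) pre_digraph \<Rightarrow> 'a \<Rightarrow> 'a config \<Rightarrow> nat" where
  "schips G s c = (\<Sum>v\<in>verts G - {s}. c v)"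

definition chi :: "('a, 'b) pre_digraph \<Rightarrow> 'a \<Rightarrow> 'a config \<Rightarrow> nat" where
  "chi G s c = (LEAST k. (\<lambda>v. c v + (if v = s then k else 0)) \<in> recurrents G)"

definition slvl :: "('a, 'b) pre_digraph \<Rightarrow> 'a \<Rightarrow> 'a config \<Rightarrow> nat" where
  "slvl G s c = chi G s c + schips G s c"

text \<open>As for \<open>level\<close>: \<open>slvl\<close> is constant on each class.\<close>

definition class_slvl :: "('a, 'b) pre_digraph \<Rightarrow> 'a \<Rightarrow> 'a config set \<Rightarrow> nat" where
  "class_slvl G s C = the_elem (slvl G s ` C)"

definition slvl_poly :: "('a, 'b) pre_digraph \<Rightarrow> 'a \<Rightarrow> int poly" where
  "slvl_poly G s = (\<Sum>C\<in>srec_classes G s. monom 1 (class_slvl G s C))"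

definition dlvl :: "('a, 'b) pre_digraph \<Rightarrow> 'a \<Rightarrow> 'a config \<Rightarrow> nat" where
  "dlvl G s c = out_degree G s + schips G s c"

definition class_dlvl :: "('a, 'b) pre_digraph \<Rightarrow> 'a \<Rightarrow> 'a config set \<Rightarrow> nat" where
  "class_dlvl G s C = Max (dlvl G s ` C)"

definition biggs_merino_poly :: "('a, 'b) pre_digraph \<Rightarrow> 'a \<Rightarrow> int poly" where
  "biggs_merino_poly G s = (\<Sum>C\<in>srec_classes G s. monom 1 (class_dlvl G s C))"

end

theory Submission
  imports Defs
begin

text \<open>By strong connectivity every vertex fires in a closed sequence of legal firings, so the first
  firing of any legally firable vertex can be moved to its front. Hence an unstable configuration
  is recurrent iff some nonempty firing sequence returns to it. This also shows that the model with
  sink terminates: a cycle there would be a cycle of the sinkless model avoiding \<open>s\<close>.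

  Let \<open>x\<close> be \<open>s\<close>-recurrent and put \<open>m\<close> chips on \<open>s\<close>. Firing \<open>s\<close> whenever all other vertices are
  stable runs through exactly the members \<open>y\<close> of the class of \<open>x\<close>, and \<open>s\<close> may fire at \<open>y\<close> iff the
  total number of chips is at least \<open>dlvl y\<close>. So the extended configuration is recurrent iff its
  number of chips is at least the d-level of the class of \<open>x\<close>, which says that \<open>slvl = dlvl\<close>.
  Every sinkless class of level \<open>n\<close> contains such extended configurations, from precisely one
  \<open>s\<close>-class, so there are as many of them as \<open>s\<close>-classes of d-level at most \<open>n\<close>.\<close>

locale strong_digraph = fin_digraph G for G :: "('a, 'b) pre_digraph" +
  assumes strong: "strongly_connected G"
begin

section \<open>The sinkless model\<close>

lemma num_arcs_eq_0: "v \<notin> verts G \<or> w \<notin> verts G \<Longrightarrow> num_arcs G v w = 0"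
  by (auto simp: num_arcs_def card_eq_0_iff)

lemma sum_num_arcs: "(\<Sum>w\<in>verts G. num_arcs G v w) = out_degree G v"
proof -
  have "out_degree G v = (\<Sum>e\<in>out_arcs G v. 1)"
    by (simp add: out_degree_def)
  also have "\<dots> = (\<Sum>w\<in>verts G. \<Sum>e\<in>{e \<in> out_arcs G v. head G e = w}. 1)"
    by (rule sum.group[symmetric]) auto
  also have "\<dots> = (\<Sum>w\<in>verts G. num_arcs G v w)"
    by (intro sum.cong refl) (auto simp: num_arcs_def intro!: arg_cong[of _ _ card])
  finally show ?thesis by simp
qed

lemma num_arcs_pos: "v \<rightarrow>\<^bsub>G\<^esub> w \<Longrightarrow> 0 < num_arcs G v w"
  by (auto simp: num_arcs_def card_gt_0_iff)

lemma fire_apply_other: "w \<noteq> v \<Longrightarrow> fire G v c w = c w + num_arcs G v w"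
  by (simp add: fire_def)

lemma fire_in_configs: "c \<in> configs G \<Longrightarrow> fire G v c \<in> configs G"
  by (auto simp: configs_def fire_def num_arcs_eq_0)

lemma chips_fire:
  assumes "v \<in> verts G" "out_degree G v \<le> c v"
  shows "chips G (fire G v c) = chips G c"
proof -
  have "chips G (fire G v c) + out_degree G v =
      (\<Sum>w\<in>verts G. fire G v c w + (if w = v then out_degree G v else 0))"
    using assms by (simp add: chips_def sum.distrib)
  also have "\<dots> = (\<Sum>w\<in>verts G. c w + num_arcs G v w)"
    using assms by (intro sum.cong) (auto simp: fire_def)
  also have "\<dots> = chips G c + out_degree G v"
    by (simp add: chips_def sum.distrib sum_num_arcs)
  finally show ?thesis by simp
qed

text \<open>For distinct vertices, legality of both firings at \<open>c\<close> keeps the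
  subtraction exact in either order, since the other firing only adds chips.\<close>

lemma fire_commute:
  assumes "out_degree G v \<le> c v" "out_degree G w \<le> c w"
  shows "fire G v (fire G w c) = fire G w (fire G v c)"
  using assms by (auto simp: fire_def fun_eq_iff)

section \<open>Legal runs and the vertices that fire in them\<close>

lemma fires_to_invariant:
  assumes "fires_to G c d" "c \<in> configs G"
  shows "d \<in> configs G" "chips G d = chips G c"
proof -
  have "d \<in> configs G \<and> chips G d = chips G c"
    using assms unfolding fires_to_def
    by (induction rule: rtranclp_induct) (auto simp: fire_step_def fire_in_configs chips_fire)
  then show "d \<in> configs G" "chips G d = chips G c" by auto
qed

lemma fires_to_trans: "fires_to G c d \<Longrightarrow> fires_to G d e \<Longrightarrow> fires_to G c e"
  by (simp add: fires_to_def)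

text \<open>The list of fired vertices is kept explicit because the arguments below depend on which
  vertices fire, and in which order.\<close>

fun firing_seq :: "'a config \<Rightarrow> 'a list \<Rightarrow> 'a config \<Rightarrow> bool" where
  "firing_seq c [] d \<longleftrightarrow> d = c"
| "firing_seq c (v # vs) d \<longleftrightarrow>
    v \<in> verts G \<and> out_degree G v \<le> c v \<and> firing_seq (fire G v c) vs d"

lemma firing_seq_append:
  "firing_seq c (vs @ ws) d \<longleftrightarrow> (\<exists>e. firing_seq c vs e \<and> firing_seq e ws d)"
  by (induction vs arbitrary: c) auto

lemma fires_to_if_firing_seq: "firing_seq c vs d \<Longrightarrow> fires_to G c d"
proof (induction vs arbitrary: c)
  case (Cons v vs)
  then have "fire_step G c (fire G v c)" by (auto simp: fire_step_def)
  then show ?case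
    using Cons by (auto simp: fires_to_def intro: converse_rtranclp_into_rtranclp)
qed (simp add: fires_to_def)

lemma firing_seq_if_tranclp:
  assumes "(fire_step G)\<^sup>+\<^sup>+ c d"
  shows "\<exists>vs. vs \<noteq> [] \<and> firing_seq c vs d"
  using assms
proof (induction rule: tranclp_induct)
  case (base y)
  then obtain v where "firing_seq c [v] y" by (auto simp: fire_step_def)
  then show ?case by blast
next
  case (step y z)
  then obtain vs v where "firing_seq c vs y" "firing_seq y [v] z"
    by (auto simp: fire_step_def)
  then have "firing_seq c (vs @ [v]) z"
    using firing_seq_append by blast
  then show ?case by blast
qed

lemma firing_seq_unfired_mono:
  "firing_seq c vs d \<Longrightarrow> w \<notin> set vs \<Longrightarrow> c w \<le> d w"
proof (induction vs arbitrary: c)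
  case (Cons v vs)
  then show ?case
    using fire_apply_other[of w v c] by fastforce
qed simp

text \<open>A vertex loses chips only by firing itself, so the chip that \<open>v\<close> sends
  along the edge to \<open>w\<close> stays there.\<close>

lemma firing_seq_unfired_strict_mono:
  assumes "firing_seq c vs d" "w \<notin> set vs" "v \<in> set vs" "v \<rightarrow>\<^bsub>G\<^esub> w"
  shows "c w < d w"
proof -
  obtain as bs where vs: "vs = as @ v # bs"
    using assms split_list by fast
  then obtain e where e: "firing_seq c as e" "firing_seq (fire G v e) bs d"
    using assms by (auto simp: firing_seq_append)
  have "c w \<le> e w" "fire G v e w \<le> d w"
    using e assms vs by (auto intro: firing_seq_unfired_mono)
  moreover have "e w < fire G v e w"
    using assms vs num_arcs_pos[of v w] by (subst fire_apply_other) auto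
  ultimately show ?thesis by simp
qed

text \<open>An unfired vertex with an edge from a fired one would end with strictly more chips than
  it had. So firing spreads from the first fired vertex along all walks.\<close>

lemma all_fired_if_closed_firing_seq:
  assumes "firing_seq c vs c" "vs \<noteq> []"
  shows "verts G \<subseteq> set vs"
proof
  fix w assume w: "w \<in> verts G"
  obtain v ws where vs: "vs = v # ws" using assms by (cases vs) auto
  then have "v \<rightarrow>\<^sup>*\<^bsub>G\<^esub> w"
    using assms strong w by (auto simp: strongly_connected_def)
  then show "w \<in> set vs"
  proof (induction rule: reachable_induct)
    case base
    then show ?case by (simp add: vs)
  next
    case (step x y)
    then show ?case
      using firing_seq_unfired_strict_mono[OF assms(1), of y x] by auto
  qed
qed

text \<open>Firing \<open>v\<close> beforehand takes chips only from \<open>v\<close>, which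
  \<open>vs\<close> never fires, so the firings in \<open>vs\<close> stay legal; commutation gives
  the end configuration.\<close>

lemma firing_seq_fire:
  assumes "firing_seq c vs d" "v \<notin> set vs" "out_degree G v \<le> c v"
  shows "firing_seq (fire G v c) vs (fire G v d)"
  using assms
proof (induction vs arbitrary: c)
  case (Cons w vs)
  then have "w \<noteq> v" by auto
  moreover have "firing_seq (fire G v (fire G w c)) vs (fire G v d)"
    using Cons by (intro Cons.IH) (auto simp: fire_def)
  ultimately show ?case
    using Cons.prems by (auto simp: fire_commute fire_apply_other)
qed simp

text \<open>The induction carries a cycle through \<open>d\<close>, not just a way back to
  \<open>c\<close>: a cycle is sure to fire the vertex \<open>v\<close> of the next step.\<close>

lemma fires_back_if_closed:
  assumes "(fire_step G)\<^sup>+\<^sup>+ c c" "fires_to G c d"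
  shows "(fire_step G)\<^sup>+\<^sup>+ d d \<and> fires_to G d c"
  using assms(2) unfolding fires_to_def
proof (induction rule: rtranclp_induct)
  case base
  show ?case using assms(1) by simp
next
  case (step d e)
  then obtain v where v: "v \<in> verts G" "out_degree G v \<le> d v" "e = fire G v d"
    by (auto simp: fire_step_def)
  obtain vs where vs: "vs \<noteq> []" "firing_seq d vs d"
    using step firing_seq_if_tranclp by blast
  obtain as bs where ab: "vs = as @ v # bs" "v \<notin> set as"
    using all_fired_if_closed_firing_seq vs v split_list_first[of v vs] by blast
  then obtain f where f: "firing_seq d as f" "firing_seq (fire G v f) bs d"
    using vs by (auto simp: firing_seq_append)
  \<comment> \<open>The first firing of \<open>v\<close> in the cycle can be moved to the front.\<close>
  have "firing_seq e (as @ bs) d"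
    using firing_seq_fire[OF f(1) ab(2) v(2)] f(2) v(3) firing_seq_append by blast
  then have "(fire_step G)\<^sup>*\<^sup>* e d"
    using fires_to_if_firing_seq by (simp add: fires_to_def)
  then show ?case
    using step by (auto intro: rtranclp_into_tranclp1)
qed

text \<open>A nonempty cycle starts with a legal firing, so \<open>c\<close> is unstable.
  Conversely, an unstable \<open>c\<close> has a legal firing, and recurrence supplies the way
  back.\<close>

lemma recurrents_iff_closed:
  "c \<in> recurrents G \<longleftrightarrow> c \<in> configs G \<and> (fire_step G)\<^sup>+\<^sup>+ c c"
proof
  assume c: "c \<in> recurrents G"
  then obtain v where "v \<in> verts G" "out_degree G v \<le> c v"
    by (auto simp: recurrents_def stable_def not_less)
  then have "fire_step G c (fire G v c)" by (auto simp: fire_step_def)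
  moreover from this have "fires_to G (fire G v c) c"
    using c by (auto simp: recurrents_def fires_to_def)
  ultimately have "(fire_step G)\<^sup>+\<^sup>+ c c"
    unfolding fires_to_def by (rule rtranclp_into_tranclp2)
  then show "c \<in> configs G \<and> (fire_step G)\<^sup>+\<^sup>+ c c"
    using c by (simp add: recurrents_def)
next
  assume c: "c \<in> configs G \<and> (fire_step G)\<^sup>+\<^sup>+ c c"
  then obtain d where "fire_step G c d" using tranclpD[of "fire_step G" c c] by blast
  then have "\<not> stable G c" by (auto simp: fire_step_def stable_def not_less)
  then show "c \<in> recurrents G"
    using c fires_back_if_closed by (auto simp: recurrents_def)
qed

section \<open>Recurrent classes and their level\<close>

lemma recurrents_closed:
  assumes "c \<in> recurrents G" "fires_to G c d"
  shows "d \<in> recurrents G"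
  using assms fires_back_if_closed fires_to_invariant recurrents_iff_closed by blast

lemma equiv_rec_rel: "equiv (recurrents G) (rec_rel G)"
proof (rule equivI)
  show "rec_rel G \<subseteq> recurrents G \<times> recurrents G" by (auto simp: rec_rel_def)
  show "refl_on (recurrents G) (rec_rel G)"
    by (auto simp: refl_on_def rec_rel_def fires_to_def)
  show "sym (rec_rel G)" by (auto simp: sym_def rec_rel_def recurrents_def)
  show "trans (rec_rel G)" by (auto simp: trans_def rec_rel_def intro: fires_to_trans)
qed

lemma level_eq_chips:
  assumes "C \<in> recurrents G // rec_rel G" "c \<in> C"
  shows "level G C = chips G c"
proof -
  have "chips G d \<in> {chips G c}" if "d \<in> C" for d
  proof -
    have "(c, d) \<in> rec_rel G"
      using quotient_eq_iff[OF equiv_rec_rel assms(1) assms(1) assms(2) that] by simp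
    then show ?thesis
      using fires_to_invariant by (auto simp: rec_rel_def recurrents_def)
  qed
  then have "chips G ` C \<subseteq> {chips G c}" by blast
  then have "chips G ` C = {chips G c}" using assms(2) by blast
  then show ?thesis by (simp add: level_def)
qed

section \<open>The model with a sink\<close>

context
  fixes s :: 'a
  assumes sink: "s \<in> verts G"
begin

section \<open>The model with sink and its lift to the sinkless model\<close>

lemma sconfigs_at_sink: "x \<in> sconfigs G s \<Longrightarrow> x s = 0"
  by (simp add: sconfigs_def)

lemma sconfigs_upd: "x \<in> sconfigs G s \<Longrightarrow> x(s := 0) = x"
  by (simp add: sconfigs_at_sink fun_upd_idem)

lemma sconfigs_add:
  "x \<in> sconfigs G s \<Longrightarrow> y \<in> sconfigs G s \<Longrightarrow> (\<lambda>v. x v + y v) \<in> sconfigs G s"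
  by (simp add: sconfigs_def)

lemma sconfigs_mult: "x \<in> sconfigs G s \<Longrightarrow> (\<lambda>v. k * x v) \<in> sconfigs G s"
  by (simp add: sconfigs_def)

lemma sink_config_in_sconfigs: "sink_config G s \<in> sconfigs G s"
  by (auto simp: sconfigs_def sink_config_def num_arcs_eq_0)

lemma sconfigs_add_sink:
  "x \<in> sconfigs G s \<Longrightarrow> (\<lambda>v. x v + k * sink_config G s v) \<in> sconfigs G s"
  using sconfigs_add sconfigs_mult sink_config_in_sconfigs by blast

lemma upd_in_configs: "x \<in> sconfigs G s \<Longrightarrow> x(s := m) \<in> configs G"
  using sink by (auto simp: sconfigs_def configs_def)

lemma upd_in_sconfigs: "c \<in> configs G \<Longrightarrow> c(s := 0) \<in> sconfigs G s"
  by (auto simp: sconfigs_def configs_def)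

lemma chips_upd: "chips G (x(s := m)) = schips G s x + m"
  using sink by (simp add: chips_def schips_def sum.remove[of "verts G" s])

lemma sfires_to_trans: "sfires_to G s x y \<Longrightarrow> sfires_to G s y z \<Longrightarrow> sfires_to G s x z"
  by (simp add: sfires_to_def)

lemma sfire_step_in_sconfigs:
  "sfire_step G s x y \<Longrightarrow> x \<in> sconfigs G s \<Longrightarrow> y \<in> sconfigs G s"
  by (auto simp: sfire_step_def sconfigs_def fire_def num_arcs_eq_0)

lemma sfires_to_in_sconfigs:
  assumes "sfires_to G s x y" "x \<in> sconfigs G s"
  shows "y \<in> sconfigs G s"
  using assms unfolding sfires_to_def
  by (induction rule: rtranclp_induct) (auto intro: sfire_step_in_sconfigs)

text \<open>Chips lost to the sink pile up on \<open>s\<close> in the sinkless model, hence the new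
  count \<open>m'\<close>. The old count \<open>m\<close> is arbitrary, as \<open>s\<close> does not
  fire.\<close>

lemma sfire_step_lift:
  assumes "sfire_step G s x y"
  shows "\<exists>v m'. v \<noteq> s \<and> firing_seq (x(s := m)) [v] (y(s := m'))"
proof -
  obtain v where v: "v \<in> verts G" "v \<noteq> s" "out_degree G v \<le> x v" "y = (fire G v x)(s := 0)"
    using assms by (auto simp: sfire_step_def)
  have "fire G v (x(s := m)) = y(s := m + num_arcs G v s)"
    using v by (auto simp: fire_def fun_eq_iff)
  then have "firing_seq (x(s := m)) [v] (y(s := m + num_arcs G v s))"
    using v by simp
  then show ?thesis using v by blast
qed

lemma sfire_tranclp_lift:
  assumes "(sfire_step G s)\<^sup>+\<^sup>+ x y"
  shows "\<exists>vs m'. vs \<noteq> [] \<and> s \<notin> set vs \<and> firing_seq (x(s := m)) vs (y(s := m'))"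
  using assms
proof (induction rule: tranclp_induct)
  case (base y)
  then obtain v m' where "v \<noteq> s" "firing_seq (x(s := m)) [v] (y(s := m'))"
    using sfire_step_lift by blast
  moreover from this have "[v] \<noteq> []" "s \<notin> set [v]" by auto
  ultimately show ?case by blast
next
  case (step y z)
  then obtain vs m' where vs: "s \<notin> set vs" "firing_seq (x(s := m)) vs (y(s := m'))"
    by blast
  obtain v m'' where v: "v \<noteq> s" "firing_seq (y(s := m')) [v] (z(s := m''))"
    using sfire_step_lift step by blast
  have "firing_seq (x(s := m)) (vs @ [v]) (z(s := m''))"
    using vs v firing_seq_append by blast
  moreover have "vs @ [v] \<noteq> []" "s \<notin> set (vs @ [v])" using vs v by auto
  ultimately show ?case by blast
qed

lemma sfires_to_lift:
  assumes "sfires_to G s x y"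
  shows "\<exists>m'. fires_to G (x(s := m)) (y(s := m'))"
proof (cases "x = y")
  case True
  then show ?thesis by (auto simp: fires_to_def)
next
  case False
  then have "(sfire_step G s)\<^sup>+\<^sup>+ x y"
    using assms rtranclpD[of "sfire_step G s" x y] by (simp add: sfires_to_def)
  then show ?thesis
    using sfire_tranclp_lift fires_to_if_firing_seq by blast
qed

lemma fires_to_lift_chips:
  assumes "x \<in> sconfigs G s" "fires_to G (x(s := m)) (y(s := m'))"
  shows "schips G s y + m' = schips G s x + m"
  using fires_to_invariant(2)[OF assms(2) upd_in_configs[OF assms(1)]] by (simp add: chips_upd)

text \<open>Conservation of chips closes up the lift of such a cycle at \<open>s\<close> too, and a
  closed run would have to fire \<open>s\<close>.\<close>

lemma not_sfire_tranclp_refl: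
  assumes "x \<in> sconfigs G s"
  shows "\<not> (sfire_step G s)\<^sup>+\<^sup>+ x x"
proof
  assume "(sfire_step G s)\<^sup>+\<^sup>+ x x"
  then obtain vs m where vs: "vs \<noteq> []" "s \<notin> set vs" "firing_seq (x(s := 0)) vs (x(s := m))"
    using sfire_tranclp_lift by blast
  then have "m = 0"
    using fires_to_lift_chips[OF assms fires_to_if_firing_seq] by fastforce
  then show False
    using vs all_fired_if_closed_firing_seq sink by blast
qed

section \<open>Termination and existence of stabilizations\<close>

lemma finite_bounded_sconfigs:
  "finite {x \<in> sconfigs G s. \<forall>v\<in>verts G - {s}. x v \<le> N}" (is "finite ?A")
proof -
  have "?A \<subseteq> {x. \<forall>v. (v \<in> verts G - {s} \<longrightarrow> x v \<in> {..N}) \<and> (v \<notin> verts G - {s} \<longrightarrow> x v = 0)}"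
    by (auto simp: sconfigs_def)
  then show ?thesis
    by (rule finite_subset) (rule finite_set_of_finite_funs; simp)
qed

lemma finite_sfires_to:
  assumes "x \<in> sconfigs G s"
  shows "finite {y. sfires_to G s x y}"
proof (rule finite_subset)
  show "{y. sfires_to G s x y} \<subseteq>
      {y \<in> sconfigs G s. \<forall>v\<in>verts G - {s}. y v \<le> schips G s x}"
  proof (intro subsetI CollectI conjI ballI)
    fix y assume "y \<in> {y. sfires_to G s x y}"
    then show "y \<in> sconfigs G s" using assms sfires_to_in_sconfigs by blast
  next
    fix y v assume "y \<in> {y. sfires_to G s x y}" and v: "v \<in> verts G - {s}"
    then have y: "sfires_to G s x y" by simp
    \<comment> \<open>Lifted with no chips on \<open>s\<close>, the run conserves the total, so the
      number of chips off \<open>s\<close> cannot grow.\<close>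
    obtain m where "fires_to G (x(s := 0)) (y(s := m))"
      using sfires_to_lift y by blast
    then have "schips G s y \<le> schips G s x"
      using fires_to_lift_chips assms by fastforce
    moreover have "y v \<le> schips G s y"
      unfolding schips_def using v by (intro member_le_sum) auto
    ultimately show "y v \<le> schips G s x" by simp
  qed
qed (rule finite_bounded_sconfigs)

lemma sfire_stepI:
  "v \<in> verts G - {s} \<Longrightarrow> out_degree G v \<le> x v \<Longrightarrow> sfire_step G s x ((fire G v x)(s := 0))"
  by (auto simp: sfire_step_def)

lemma sstable_if_no_step: "(\<And>y. \<not> sfire_step G s x y) \<Longrightarrow> sstable G s x"
  by (auto simp: sstable_def sfire_step_def not_less[symmetric])

lemma no_step_if_sstable: "sstable G s x \<Longrightarrow> \<not> sfire_step G s x y"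
  unfolding sstable_def sfire_step_def by (meson leD)

lemma ex_stabilization:
  assumes "x \<in> sconfigs G s"
  shows "\<exists>y. sfires_to G s x y \<and> sstable G s y"
proof -
  let ?A = "{y. sfires_to G s x y}"
  \<comment> \<open>The pairs are reversed, so that a minimal element for \<open>?r\<close> admits
    no further firing. As \<open>?r\<close> is finite, acyclicity makes it well-founded.\<close>
  let ?r = "{(z, y). y \<in> ?A \<and> sfire_step G s y z}"
  have r: "?r \<subseteq> {(z, y). sfire_step G s y z}" by auto
  have "?r \<subseteq> ?A \<times> ?A"
    by (auto simp: sfires_to_def)
  then have "finite ?r"
    using finite_sfires_to[OF assms] by (meson finite_SigmaI finite_subset)
  moreover have "acyclic ?r"
  proof (rule acyclicI, rule allI, rule notI)
    fix y assume y: "(y, y) \<in> ?r\<^sup>+"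
    then have "y \<in> ?A"
      using \<open>?r \<subseteq> ?A \<times> ?A\<close> trancl_subset_Sigma by blast
    moreover have "(y, y) \<in> ({(y, z). sfire_step G s y z}\<inverse>)\<^sup>+"
      using y trancl_mono_subset[OF r] by (auto simp: converse_unfold)
    then have "(sfire_step G s)\<^sup>+\<^sup>+ y y"
      by (simp add: trancl_converse tranclp_unfold)
    ultimately show False
      using not_sfire_tranclp_refl sfires_to_in_sconfigs assms by blast
  qed
  ultimately have "wf ?r" by (rule finite_acyclic_wf)
  moreover have "x \<in> ?A" by (simp add: sfires_to_def)
  ultimately obtain y where "y \<in> ?A" "\<And>z. (z, y) \<in> ?r \<Longrightarrow> z \<notin> ?A"
    by (rule wfE_min) blast
  then have "sfires_to G s x y" "\<And>z. \<not> sfire_step G s y z"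
    by (auto simp: sfires_to_def dest: rtranclp.rtrancl_into_rtrancl)
  then show ?thesis using sstable_if_no_step by blast
qed

section \<open>Confluence and uniqueness of stabilizations\<close>

lemma sfire_step_diamond:
  assumes "sfire_step G s x y" "sfire_step G s x z"
  shows "y = z \<or> (\<exists>w. sfire_step G s y w \<and> sfire_step G s z w)"
proof -
  obtain a where a: "a \<in> verts G - {s}" "out_degree G a \<le> x a" "y = (fire G a x)(s := 0)"
    using assms by (auto simp: sfire_step_def)
  obtain b where b: "b \<in> verts G - {s}" "out_degree G b \<le> x b" "z = (fire G b x)(s := 0)"
    using assms by (auto simp: sfire_step_def)
  show ?thesis
  proof (cases "a = b")
    case False
    \<comment> \<open>Firing \<open>a\<close> takes no chips from \<open>b\<close> and conversely,
      so each firing remains legal after the other.\<close>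
    have "sfire_step G s y ((fire G b y)(s := 0))" "sfire_step G s z ((fire G a z)(s := 0))"
      using a b False by (auto intro!: sfire_stepI simp: fire_apply_other)
    moreover have "(fire G b y)(s := 0) = (fire G a z)(s := 0)"
      using a b False by (auto simp: fire_def fun_eq_iff)
    ultimately show ?thesis by metis
  qed (use a b in simp)
qed

text \<open>Induction along the run to \<open>z\<close>, closing one diamond per step. The
  alternative \<open>z = w\<close> covers a run that has already met the one from
  \<open>y\<close>.\<close>

lemma sfires_to_strip:
  assumes "sfires_to G s x z" "sfire_step G s x y"
  shows "\<exists>w. sfires_to G s y w \<and> (z = w \<or> sfire_step G s z w)"
  using assms unfolding sfires_to_def
proof (induction rule: rtranclp_induct)
  case base
  then show ?case by blast
next
  case (step z z')
  then obtain w where w: "(sfire_step G s)\<^sup>*\<^sup>* y w" "z = w \<or> sfire_step G s z w"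
    by blast
  show ?case
  proof (cases "z = w")
    case True
    then have "(sfire_step G s)\<^sup>*\<^sup>* y z'"
      using step.hyps(2) w(1) rtranclp.rtrancl_into_rtrancl by simp
    then show ?thesis by blast
  next
    case False
    then consider "w = z'" | w' where "sfire_step G s w w'" "sfire_step G s z' w'"
      using sfire_step_diamond[of z w z'] step.hyps(2) w(2) by blast
    then show ?thesis
      using w(1) rtranclp.rtrancl_into_rtrancl[OF w(1)] by cases blast+
  qed
qed

text \<open>A stable \<open>z\<close> has no further step, so only the alternative
  \<open>z = w\<close> of \<open>sfires_to_strip\<close> is left; each step away from
  \<open>x\<close> keeps \<open>z\<close> reachable.\<close>

lemma sfires_to_if_sstable:
  assumes "sfires_to G s x y" "sfires_to G s x z" "sstable G s z"
  shows "sfires_to G s y z"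
  using assms(1) unfolding sfires_to_def
proof (induction rule: rtranclp_induct)
  case base
  then show ?case using assms(2) by (simp add: sfires_to_def)
next
  case (step y y')
  then show ?case
    using sfires_to_strip[of y z y'] no_step_if_sstable[OF assms(3)]
    by (auto simp: sfires_to_def)
qed

lemma sfires_to_from_sstable: "sfires_to G s x y \<Longrightarrow> sstable G s x \<Longrightarrow> y = x"
  unfolding sfires_to_def by (metis converse_rtranclpE no_step_if_sstable)

lemma stabilization_eqI:
  assumes "sfires_to G s x y" "sstable G s y"
  shows "stabilization G s x = y"
  unfolding stabilization_def
proof (rule the_equality)
  fix z assume "sfires_to G s x z \<and> sstable G s z"
  then show "z = y"
    using sfires_to_if_sstable[OF assms(1), of z] sfires_to_from_sstable[OF _ assms(2)] by blast
qed (use assms in simp)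

lemma stabilization_props:
  assumes "x \<in> sconfigs G s"
  shows "sfires_to G s x (stabilization G s x)" "sstable G s (stabilization G s x)"
    "stabilization G s x \<in> sconfigs G s"
proof -
  obtain y where "sfires_to G s x y" "sstable G s y"
    using ex_stabilization[OF assms] by blast
  moreover from this have "stabilization G s x = y" by (rule stabilization_eqI)
  ultimately show "sfires_to G s x (stabilization G s x)" "sstable G s (stabilization G s x)"
    "stabilization G s x \<in> sconfigs G s"
    using sfires_to_in_sconfigs assms by auto
qed

section \<open>Stabilization of sums and repeated firing of the sink\<close>

lemma stabilization_sstable: "sstable G s x \<Longrightarrow> stabilization G s x = x"
  by (rule stabilization_eqI) (simp_all add: sfires_to_def)

lemma stabilization_sfires_to:
  assumes "sfires_to G s x y" "x \<in> sconfigs G s"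
  shows "stabilization G s x = stabilization G s y"
  using assms stabilization_props(1,2)[OF sfires_to_in_sconfigs[OF assms]]
  by (intro stabilization_eqI) (auto intro: sfires_to_trans)

text \<open>Additional chips never make a firing illegal, and \<open>z\<close> is \<open>0\<close>
  at \<open>s\<close>, so resetting \<open>s\<close> does not affect it.\<close>

lemma sfires_to_add:
  assumes "sfires_to G s x y" "z \<in> sconfigs G s"
  shows "sfires_to G s (\<lambda>v. x v + z v) (\<lambda>v. y v + z v)"
  using assms(1) unfolding sfires_to_def
proof (induction rule: rtranclp_induct)
  case (step y y')
  then obtain v where v: "v \<in> verts G - {s}" "out_degree G v \<le> y v" "y' = (fire G v y)(s := 0)"
    by (auto simp: sfire_step_def)
  have "(\<lambda>w. y' w + z w) = (fire G v (\<lambda>w. y w + z w))(s := 0)"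
    using v sconfigs_at_sink[OF assms(2)] by (auto simp: fire_def fun_eq_iff)
  then have "sfire_step G s (\<lambda>w. y w + z w) (\<lambda>w. y' w + z w)"
    using v unfolding sfire_step_def by (intro bexI[of _ v]) auto
  then show ?case using rtranclp.rtrancl_into_rtrancl[OF step.IH] by simp
qed simp

text \<open>The abelian property: the firings that stabilize \<open>x\<close> are also legal on top
  of \<open>y\<close>, and doing them first does not change the result.\<close>

lemma stabilization_add:
  assumes "x \<in> sconfigs G s" "y \<in> sconfigs G s"
  shows "stabilization G s (\<lambda>v. stabilization G s x v + y v) = stabilization G s (\<lambda>v. x v + y v)"
  using assms
  by (intro stabilization_sfires_to[symmetric] sfires_to_add stabilization_props sconfigs_add)

text \<open>\<open>push k x\<close> is the configuration that \<open>k\<close> firings of the sink produce from \<open>x\<close>.\<close>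

definition push :: "nat \<Rightarrow> 'a config \<Rightarrow> 'a config" where
  "push k x = stabilization G s (\<lambda>v. x v + k * sink_config G s v)"

lemma push_props:
  assumes "x \<in> sconfigs G s"
  shows "sfires_to G s (\<lambda>v. x v + k * sink_config G s v) (push k x)" "sstable G s (push k x)"
    "push k x \<in> sconfigs G s"
  unfolding push_def using stabilization_props[OF sconfigs_add_sink[OF assms]] by auto

lemma push_0: "sstable G s x \<Longrightarrow> push 0 x = x"
  by (simp add: push_def stabilization_sstable)

text \<open>By \<open>stabilization_add\<close> it does not matter whether the other vertices relax
  between firings of the sink.\<close>

lemma push_push:
  assumes "x \<in> sconfigs G s"
  shows "push j (push k x) = push (k + j) x"
  unfolding push_def
  by (subst stabilization_add)
    (simp_all add: assms sconfigs_add_sink sconfigs_mult sink_config_in_sconfigs algebra_simps)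

text \<open>Taking \<open>x\<close> to be zero, this carries coincidences between pushes over to
  every \<open>y\<close>.\<close>

lemma push_stabilization_add:
  assumes "x \<in> sconfigs G s" "y \<in> sconfigs G s"
  shows "stabilization G s (\<lambda>v. push k x v + y v) = push k (\<lambda>v. x v + y v)"
  unfolding push_def
  by (subst stabilization_add) (simp_all add: assms sconfigs_add_sink algebra_simps)

lemma finite_sstable: "finite {x \<in> sconfigs G s. sstable G s x}"
proof -
  have "x v \<le> (\<Sum>w\<in>verts G. out_degree G w)" if "sstable G s x" "v \<in> verts G - {s}" for x v
  proof -
    have "x v \<le> out_degree G v" using that by (auto simp: sstable_def less_imp_le)
    also have "\<dots> \<le> (\<Sum>w\<in>verts G. out_degree G w)"
      using that by (intro member_le_sum) auto
    finally show ?thesis .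
  qed
  then show ?thesis
    by (intro finite_subset[OF _ finite_bounded_sconfigs[of "\<Sum>w\<in>verts G. out_degree G w"]]) auto
qed

section \<open>Loading the graph by firing the sink\<close>

lemma sfires_to_mult:
  assumes "sfires_to G s x y" "x \<in> sconfigs G s"
  shows "sfires_to G s (\<lambda>v. k * x v) (\<lambda>v. k * y v)"
proof (induction k)
  case 0
  then show ?case by (simp add: sfires_to_def)
next
  case (Suc k)
  have y: "y \<in> sconfigs G s" using assms sfires_to_in_sconfigs by blast
  \<comment> \<open>First \<open>k\<close> copies move beside an untouched \<open>x\<close>, then
    the last copy moves beside the \<open>k\<close> results.\<close>
  have "sfires_to G s (\<lambda>v. k * x v + x v) (\<lambda>v. k * y v + x v)"
    using sfires_to_add[OF Suc assms(2)] .
  moreover have "sfires_to G s (\<lambda>v. x v + k * y v) (\<lambda>v. y v + k * y v)"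
    using sfires_to_add[OF assms(1) sconfigs_mult[OF y]] .
  ultimately show ?case
    using sfires_to_trans by (fastforce simp: add.commute)
qed

text \<open>Chips travel along a walk from \<open>s\<close> to \<open>v\<close>. To pass one on from
  \<open>x\<close>, the load is repeated \<open>out_degree G x\<close> times, which lets
  \<open>x\<close> fire.\<close>

lemma ex_load_vertex:
  assumes "v \<in> verts G" "v \<noteq> s"
  shows "\<exists>N e. sfires_to G s (\<lambda>w. N * sink_config G s w) e \<and> 0 < e v"
proof -
  have "s \<rightarrow>\<^sup>*\<^bsub>G\<^esub> v"
    using strong assms(1) sink by (auto simp: strongly_connected_def)
  then show ?thesis using assms(2)
  proof (induction rule: reachable_induct)
    case (step x y)
    consider "x = s" | "x = y" | "x \<noteq> s" "x \<noteq> y" by blast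
    then show ?case
    proof cases
      case 1
      then have "0 < 1 * sink_config G s y"
        using step num_arcs_pos[of x y] by (simp add: sink_config_def)
      moreover have "sfires_to G s (\<lambda>w. 1 * sink_config G s w) (\<lambda>w. 1 * sink_config G s w)"
        by (simp add: sfires_to_def)
      ultimately show ?thesis by blast
    next
      case 2
      then show ?thesis using step by blast
    next
      case 3
      let ?d = "out_degree G x"
      obtain N e where e: "sfires_to G s (\<lambda>w. N * sink_config G s w) e" "0 < e x"
        using step 3 by blast
      have "sfires_to G s (\<lambda>w. (?d * N) * sink_config G s w) (\<lambda>w. ?d * e w)"
        using sfires_to_mult[OF e(1) sconfigs_mult[OF sink_config_in_sconfigs], of ?d]
        by (simp add: mult.assoc)
      moreover have "sfire_step G s (\<lambda>w. ?d * e w) ((fire G x (\<lambda>w. ?d * e w))(s := 0))"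
        using 3 e step(2) adj_in_verts(1) by (intro sfire_stepI) auto
      ultimately have "sfires_to G s (\<lambda>w. (?d * N) * sink_config G s w)
          ((fire G x (\<lambda>w. ?d * e w))(s := 0))"
        unfolding sfires_to_def by simp
      moreover have "0 < ((fire G x (\<lambda>w. ?d * e w))(s := 0)) y"
        using 3 step num_arcs_pos[of x y] by (simp add: fire_apply_other)
      ultimately show ?thesis by blast
    qed
  qed simp
qed

text \<open>Loads for single vertices add up, so sink firings can cover \<open>x\<close>, with
  surplus \<open>e\<close>. This later makes periodic configurations recurrent.\<close>

lemma ex_load:
  assumes x: "x \<in> sconfigs G s"
  shows "\<exists>N e. e \<in> sconfigs G s \<and>
    sfires_to G s (\<lambda>w. N * sink_config G s w) (\<lambda>w. x w + e w)"
proof -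
  have "\<exists>N e. sfires_to G s (\<lambda>w. N * sink_config G s w) e \<and> (\<forall>v\<in>A. x v \<le> e v)"
    if "finite A" "A \<subseteq> verts G - {s}" for A
    using that
  proof (induction A rule: finite_induct)
    case empty
    have "sfires_to G s (\<lambda>w. 0 * sink_config G s w) (\<lambda>w. 0 * sink_config G s w)"
      by (simp add: sfires_to_def)
    then show ?case by blast
  next
    case (insert a A)
    then obtain N e where e: "sfires_to G s (\<lambda>w. N * sink_config G s w) e" "\<forall>v\<in>A. x v \<le> e v"
      by blast
    obtain M f where f: "sfires_to G s (\<lambda>w. M * sink_config G s w) f" "0 < f a"
      using ex_load_vertex[of a] insert by blast
    \<comment> \<open>Each of the \<open>x a\<close> copies puts at least one chip on
      \<open>a\<close>.\<close>
    have xf: "sfires_to G s (\<lambda>w. x a * (M * sink_config G s w)) (\<lambda>w. x a * f w)"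
      using sfires_to_mult[OF f(1) sconfigs_mult[OF sink_config_in_sconfigs]] .
    have e_conf: "e \<in> sconfigs G s"
      using sfires_to_in_sconfigs[OF e(1) sconfigs_mult[OF sink_config_in_sconfigs]] .
    have "sfires_to G s (\<lambda>w. N * sink_config G s w + x a * (M * sink_config G s w))
        (\<lambda>w. e w + x a * (M * sink_config G s w))"
      by (intro sfires_to_add e(1) sconfigs_mult sink_config_in_sconfigs)
    moreover have "sfires_to G s (\<lambda>w. x a * (M * sink_config G s w) + e w) (\<lambda>w. x a * f w + e w)"
      by (intro sfires_to_add xf e_conf)
    ultimately have "sfires_to G s (\<lambda>w. (N + x a * M) * sink_config G s w) (\<lambda>w. e w + x a * f w)"
      using sfires_to_trans by (simp add: algebra_simps)
    moreover have "x a \<le> x a * f a" using f(2) by simp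
    then have "\<forall>v\<in>insert a A. x v \<le> e v + x a * f v"
      using e(2) by (auto intro: trans_le_add1 trans_le_add2)
    ultimately show ?case by blast
  qed
  from this[of "verts G - {s}"] obtain N e where
    e: "sfires_to G s (\<lambda>w. N * sink_config G s w) e" "\<forall>v\<in>verts G - {s}. x v \<le> e v"
    by auto
  have "e \<in> sconfigs G s"
    using sfires_to_in_sconfigs[OF e(1) sconfigs_mult[OF sink_config_in_sconfigs]] .
  then have "(\<lambda>w. e w - x w) \<in> sconfigs G s"
    by (auto simp: sconfigs_def)
  moreover have "(\<lambda>w. x w + (e w - x w)) = e"
  proof
    fix w
    show "x w + (e w - x w) = e w"
      using e(2) x \<open>e \<in> sconfigs G s\<close> by (cases "w \<in> verts G - {s}") (auto simp: sconfigs_def)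
  qed
  ultimately show ?thesis using e(1) by metis
qed

section \<open>Recurrence with sink as periodicity under \<open>push\<close>\<close>

lemma zero_in_sconfigs: "(\<lambda>_. 0) \<in> sconfigs G s"
  by (simp add: sconfigs_def)

lemma srecurrentsD:
  assumes "x \<in> srecurrents G s" "y \<in> sconfigs G s"
  shows "\<exists>z\<in>sconfigs G s. stabilization G s (\<lambda>v. y v + z v) = x"
  using assms by (simp add: srecurrents_def)

lemma srecurrents_props:
  assumes "x \<in> srecurrents G s"
  shows "x \<in> sconfigs G s" "sstable G s x"
proof -
  show "x \<in> sconfigs G s" using assms by (simp add: srecurrents_def)
  obtain y where "y \<in> sconfigs G s" "stabilization G s (\<lambda>v. 0 + y v) = x"
    using srecurrentsD[OF assms zero_in_sconfigs] by blast
  then show "sstable G s x" using stabilization_props(2) by auto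
qed

text \<open>There are finitely many stable configurations, so two pushes of zero agree; the
  difference of their exponents is a common period.\<close>

lemma ex_push_period: "\<exists>p>0. \<forall>x\<in>srecurrents G s. push p x = x"
proof -
  have "range (\<lambda>i. push i (\<lambda>_. 0)) \<subseteq> {x \<in> sconfigs G s. sstable G s x}"
    using push_props[OF zero_in_sconfigs] by auto
  then have "\<not> inj (\<lambda>i. push i (\<lambda>_. 0))"
    using finite_sstable finite_subset range_inj_infinite by blast
  then obtain i j where ij: "i < j" "push i (\<lambda>_. 0) = push j (\<lambda>_. 0)"
    unfolding inj_def by (metis nat_neq_iff)
  have "push (j - i) x = x" if x: "x \<in> srecurrents G s" for x
  proof -
    \<comment> \<open>Recurrence, applied to \<open>i\<close> copies of the sink's chips, exhibits
      \<open>x\<close> as \<open>push i y\<close>.\<close>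
    have "(\<lambda>v. i * sink_config G s v) \<in> sconfigs G s"
      by (intro sconfigs_mult sink_config_in_sconfigs)
    then obtain y where y: "y \<in> sconfigs G s"
      "stabilization G s (\<lambda>v. i * sink_config G s v + y v) = x"
      using srecurrentsD[OF x] by blast
    then have yx: "push i y = x" by (simp add: push_def add.commute)
    have "push k y = stabilization G s (\<lambda>v. push k (\<lambda>_. 0) v + y v)" for k
      using push_stabilization_add[OF zero_in_sconfigs y(1)] by simp
    then have "push j y = push i y" using ij by metis
    then show ?thesis using push_push[OF y(1), of "j - i" i] ij yx by simp
  qed
  then show ?thesis using ij by (intro exI[of _ "j - i"]) auto
qed

lemma push_mult_period:
  assumes "x \<in> sconfigs G s" "sstable G s x" "push p x = x"
  shows "push (n * p) x = x"
proof (induction n)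
  case (Suc n)
  have "push (Suc n * p) x = push (n * p) (push p x)"
    by (simp add: push_push assms(1))
  then show ?case using Suc assms(3) by simp
qed (simp add: push_0 assms)

text \<open>\<open>N\<close> pushes can load any \<open>y\<close>, and by periodicity
  \<open>x\<close> arises by \<open>N\<close> pushes from another member of its cycle; so
  \<open>x\<close> is a stabilization of \<open>y\<close> plus something.\<close>

lemma srecurrents_if_push_period:
  assumes "x \<in> sconfigs G s" "sstable G s x" "0 < p" "push p x = x"
  shows "x \<in> srecurrents G s"
proof -
  have "\<exists>z\<in>sconfigs G s. stabilization G s (\<lambda>v. y v + z v) = x" if y: "y \<in> sconfigs G s" for y
  proof -
    obtain N e where e: "e \<in> sconfigs G s"
      "sfires_to G s (\<lambda>w. N * sink_config G s w) (\<lambda>w. y w + e w)"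
      using ex_load[OF y] by blast
    \<comment> \<open>As \<open>p\<close> is positive, \<open>N * p - N\<close> is a true
      difference, and \<open>N\<close> further pushes complete \<open>N\<close> periods.\<close>
    let ?x = "push (N * p - N) x"
    have x': "?x \<in> sconfigs G s" using push_props assms by blast
    have "x = push N ?x"
      using push_push[OF assms(1), of N "N * p - N"] push_mult_period[OF assms(1,2,4)] assms(3)
      by simp
    also have "\<dots> = stabilization G s (\<lambda>v. N * sink_config G s v + ?x v)"
      by (simp add: push_def[of N] add.commute)
    also have "\<dots> = stabilization G s (\<lambda>v. y v + e v + ?x v)"
      by (intro stabilization_sfires_to sfires_to_add e x' sconfigs_add sconfigs_mult
          sink_config_in_sconfigs)
    finally have "stabilization G s (\<lambda>v. y v + (e v + ?x v)) = x"
      by (simp add: add.assoc)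
    then show ?thesis by (intro bexI[OF _ sconfigs_add[OF e(1) x']])
  qed
  then show ?thesis using assms by (simp add: srecurrents_def)
qed

lemma push_in_srecurrents:
  assumes "x \<in> srecurrents G s"
  shows "push k x \<in> srecurrents G s"
proof -
  note x = srecurrents_props[OF assms]
  obtain p where p: "p > 0" "push p x = x" using ex_push_period assms by blast
  have "push p (push k x) = push k (push p x)"
    by (simp add: push_push x add.commute)
  then show ?thesis
    using p by (intro srecurrents_if_push_period[OF push_props(3,2)[OF x(1)], of p]) auto
qed

lemma push_reverse:
  assumes "x \<in> srecurrents G s"
  shows "\<exists>j. push j (push k x) = x"
proof -
  note x = srecurrents_props[OF assms]
  obtain p where p: "p > 0" "push p x = x" using ex_push_period assms by blast
  have "push (k * p - k) (push k x) = push (k * p) x"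
    using p(1) by (simp add: push_push x)
  then show ?thesis using push_mult_period[OF x p(2)] by metis
qed

section \<open>The classes with sink as orbits of \<open>push\<close>\<close>

lemma srec_rel_iff:
  "(x, y) \<in> srec_rel G s \<longleftrightarrow> x \<in> srecurrents G s \<and> (\<exists>k. y = push k x)"
  using push_in_srecurrents by (auto simp: srec_rel_def push_def[symmetric])

lemma equiv_srec_rel: "equiv (srecurrents G s) (srec_rel G s)"
proof (rule equivI)
  show "srec_rel G s \<subseteq> srecurrents G s \<times> srecurrents G s" by (auto simp: srec_rel_def)
  show "refl_on (srecurrents G s) (srec_rel G s)"
    unfolding refl_on_def srec_rel_iff using srecurrents_props push_0 by metis
  show "sym (srec_rel G s)"
    unfolding sym_def srec_rel_iff using push_reverse push_in_srecurrents by metis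
  show "trans (srec_rel G s)"
    unfolding trans_def srec_rel_iff using srecurrents_props(1) push_push by metis
qed

lemma finite_srecurrents: "finite (srecurrents G s)"
  using finite_subset[OF _ finite_sstable] srecurrents_props by blast

lemma finite_srec_classes: "finite (srec_classes G s)"
  unfolding srec_classes_def by (rule finite_quotient[OF finite_srecurrents])
    (auto simp: srec_rel_def)

text \<open>Pushes are undone by further pushes, so the forward orbit of any member is already the
  whole class.\<close>

lemma srec_class_eq_range:
  assumes "C \<in> srec_classes G s" "x \<in> C"
  shows "x \<in> srecurrents G s" "C = range (\<lambda>k. push k x)"
proof -
  obtain y where y: "C = srec_rel G s `` {y}"
    using assms(1) unfolding srec_classes_def by (rule quotientE)
  then have "(y, x) \<in> srec_rel G s" using assms(2) by simp
  then have *: "srec_rel G s `` {x} = C"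
    unfolding y by (rule equiv_class_eq[OF equiv_srec_rel, symmetric])
  show "x \<in> srecurrents G s"
    using * assms(2) by (auto simp: srec_rel_def)
  then show "C = range (\<lambda>k. push k x)"
    using srec_rel_iff unfolding *[symmetric] by auto
qed

lemma finite_srec_class: "C \<in> srec_classes G s \<Longrightarrow> finite C"
  using srec_class_eq_range(1) finite_subset[OF _ finite_srecurrents] by blast

section \<open>Comparison of the two models\<close>

text \<open>A recurrent configuration is unstable, and with all other vertices stable only
  \<open>s\<close> can fire.\<close>

lemma out_degree_le_if_recurrent:
  assumes "x(s := m) \<in> recurrents G" "sstable G s x"
  shows "out_degree G s \<le> m"
proof -
  obtain v where v: "v \<in> verts G" "out_degree G v \<le> (x(s := m)) v"
    using assms(1) by (auto simp: recurrents_def stable_def not_less)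
  then have "v = s"
    using assms(2) by (cases "v = s") (auto simp: sstable_def not_less[symmetric])
  then show ?thesis using v by simp
qed

text \<open>One round: \<open>s\<close> fires, then the others relax. The transitive closure records
  that something fires, so that returning rounds form a genuine cycle.\<close>

lemma fire_sink:
  assumes "x \<in> sconfigs G s" "out_degree G s \<le> m"
  shows "\<exists>m'. (fire_step G)\<^sup>+\<^sup>+ (x(s := m)) ((push 1 x)(s := m'))"
proof -
  \<comment> \<open>Firing \<open>s\<close> costs its out-degree, but its loops return
    \<open>num_arcs G s s\<close> chips.\<close>
  let ?y = "\<lambda>v. x v + 1 * sink_config G s v" and ?m = "m - out_degree G s + num_arcs G s s"
  have "fire G s (x(s := m)) = ?y(s := ?m)"
    by (auto simp: fire_def sink_config_def fun_eq_iff)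
  then have "fire_step G (x(s := m)) (?y(s := ?m))"
    using assms(2) sink unfolding fire_step_def by (intro bexI[of _ s]) simp_all
  moreover obtain m' where "fires_to G (?y(s := ?m)) ((push 1 x)(s := m'))"
    using sfires_to_lift push_props(1)[OF assms(1)] by blast
  ultimately have "(fire_step G)\<^sup>+\<^sup>+ (x(s := m)) ((push 1 x)(s := m'))"
    unfolding fires_to_def by (rule rtranclp_into_tranclp2)
  then show ?thesis ..
qed

text \<open>Recurrence survives every round, so \<open>s\<close> can always fire again.\<close>

lemma fires_to_push_if_recurrent:
  assumes "x \<in> srecurrents G s" "x(s := m) \<in> recurrents G"
  shows "\<exists>m'. fires_to G (x(s := m)) ((push k x)(s := m'))"
proof (induction k)
  case 0
  show ?case
    using push_0[OF srecurrents_props(2)[OF assms(1)]] by (auto simp: fires_to_def)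
next
  case (Suc k)
  then obtain m' where m': "fires_to G (x(s := m)) ((push k x)(s := m'))" by blast
  note x = srecurrents_props[OF assms(1)] and y = push_props(2,3)[OF srecurrents_props(1)[OF assms(1)]]
  have "(push k x)(s := m') \<in> recurrents G"
    using recurrents_closed assms m' by blast
  then obtain m'' where "(fire_step G)\<^sup>+\<^sup>+ ((push k x)(s := m')) ((push 1 (push k x))(s := m''))"
    using fire_sink[OF y(2)] out_degree_le_if_recurrent y by blast
  then have "fires_to G ((push k x)(s := m')) ((push (Suc k) x)(s := m''))"
    using push_push[OF x(1)] by (simp add: fires_to_def tranclp_into_rtranclp)
  then show ?case using m' fires_to_trans by blast
qed

text \<open>By conservation, \<open>s\<close> holds
  \<open>schips G s x + m - schips G s (push k x)\<close> chips when the others reach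
  \<open>push k x\<close>; the bound says that \<open>s\<close> can fire there.\<close>

lemma upd_recurrent_iff:
  assumes "x \<in> srecurrents G s"
  shows "x(s := m) \<in> recurrents G \<longleftrightarrow>
    (\<forall>k. out_degree G s + schips G s (push k x) \<le> schips G s x + m)"
proof
  note x = srecurrents_props[OF assms]
  assume rec: "x(s := m) \<in> recurrents G"
  show "\<forall>k. out_degree G s + schips G s (push k x) \<le> schips G s x + m"
  proof
    fix k
    obtain m' where m': "fires_to G (x(s := m)) ((push k x)(s := m'))"
      using fires_to_push_if_recurrent assms rec by blast
    then have "out_degree G s \<le> m'"
      using recurrents_closed rec out_degree_le_if_recurrent push_props(2)[OF x(1)] by blast
    then show "out_degree G s + schips G s (push k x) \<le> schips G s x + m"
      using fires_to_lift_chips[OF x(1) m'] by simp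
  qed
next
  note x = srecurrents_props[OF assms]
  assume bound: "\<forall>k. out_degree G s + schips G s (push k x) \<le> schips G s x + m"
  \<comment> \<open>The sink can be fired each time the other vertices have stabilized.\<close>
  have run: "\<exists>m'. (fire_step G)\<^sup>+\<^sup>+ (x(s := m)) ((push (Suc k) x)(s := m'))" for k
  proof (induction k)
    case 0
    have "out_degree G s \<le> m" using bound[rule_format, of 0] by (simp add: push_0 x)
    then show ?case using fire_sink[OF x(1)] by (simp only: One_nat_def)
  next
    case (Suc k)
    then obtain m' where m': "(fire_step G)\<^sup>+\<^sup>+ (x(s := m)) ((push (Suc k) x)(s := m'))"
      by blast
    then have "schips G s (push (Suc k) x) + m' = schips G s x + m"
      using fires_to_lift_chips[OF x(1)] by (simp add: fires_to_def tranclp_into_rtranclp)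
    then have "out_degree G s \<le> m'"
      using bound[rule_format, of "Suc k"] by simp
    then obtain m'' where
      "(fire_step G)\<^sup>+\<^sup>+ ((push (Suc k) x)(s := m')) ((push 1 (push (Suc k) x))(s := m''))"
      using fire_sink push_props(3)[OF x(1)] by blast
    then have "(fire_step G)\<^sup>+\<^sup>+ ((push (Suc k) x)(s := m')) ((push (Suc (Suc k)) x)(s := m''))"
      using push_push[OF x(1)] by simp
    then show ?case using m' tranclp_trans by fast
  qed
  \<comment> \<open>The runs end at \<open>push (Suc k) x\<close>, so \<open>k = p - 1\<close>
    completes one period; conservation then restores the count on \<open>s\<close>.\<close>
  obtain p where p: "p > 0" "push p x = x" using ex_push_period assms by blast
  then obtain m' where m': "(fire_step G)\<^sup>+\<^sup>+ (x(s := m)) (x(s := m'))"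
    using run[of "p - 1"] by auto
  then have "m' = m"
    using fires_to_lift_chips[OF x(1), of m x m'] by (simp add: fires_to_def tranclp_into_rtranclp)
  then show "x(s := m) \<in> recurrents G"
    using m' upd_in_configs[OF x(1)] recurrents_iff_closed by blast
qed

text \<open>The class is finite and is the orbit of \<open>x\<close>, so the bounds for all
  \<open>k\<close> collapse to one on the maximum.\<close>

lemma upd_recurrent_iff_class_dlvl:
  assumes "C \<in> srec_classes G s" "x \<in> C"
  shows "x(s := m) \<in> recurrents G \<longleftrightarrow> class_dlvl G s C \<le> schips G s x + m"
proof -
  note x = srec_class_eq_range[OF assms]
  have "class_dlvl G s C \<le> schips G s x + m \<longleftrightarrow> (\<forall>y\<in>C. dlvl G s y \<le> schips G s x + m)"
    unfolding class_dlvl_def using finite_srec_class[OF assms(1)] assms(2)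
    by (subst Max_le_iff) auto
  also have "\<dots> \<longleftrightarrow> (\<forall>k. out_degree G s + schips G s (push k x) \<le> schips G s x + m)"
    unfolding x(2) dlvl_def by simp
  finally show ?thesis using upd_recurrent_iff[OF x(1)] by blast
qed

lemma slvl_eq_class_dlvl:
  assumes "C \<in> srec_classes G s" "x \<in> C"
  shows "slvl G s x = class_dlvl G s C"
proof -
  have "x s = 0"
    using srec_class_eq_range(1)[OF assms] srecurrents_props(1) sconfigs_at_sink by blast
  then have "(\<lambda>v. x v + (if v = s then k else 0)) = x(s := k)" for k
    by (auto simp: fun_eq_iff)
  then have "chi G s x = (LEAST k. class_dlvl G s C \<le> schips G s x + k)"
    unfolding chi_def using upd_recurrent_iff_class_dlvl[OF assms] by simp
  also have "\<dots> = class_dlvl G s C - schips G s x"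
    by (rule Least_equality) auto
  finally have chi: "chi G s x = class_dlvl G s C - schips G s x" .
  \<comment> \<open>The maximum is at least the d-level of \<open>x\<close> itself, so the
    subtraction in \<open>chi\<close> is exact.\<close>
  have "dlvl G s x \<le> class_dlvl G s C"
    unfolding class_dlvl_def using finite_srec_class[OF assms(1)] assms(2) by simp
  then show ?thesis by (simp add: slvl_def chi dlvl_def)
qed

lemma class_slvl_eq_class_dlvl:
  assumes "C \<in> srec_classes G s"
  shows "class_slvl G s C = class_dlvl G s C"
proof -
  have "C \<noteq> {}"
    using assms in_quotient_imp_non_empty[OF equiv_srec_rel] by (simp add: srec_classes_def)
  then have "slvl G s ` C = {class_dlvl G s C}"
    using slvl_eq_class_dlvl[OF assms] by auto
  then show ?thesis by (simp add: class_slvl_def)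
qed

section \<open>From sinkless classes to classes with sink\<close>

lemma fires_to_project:
  assumes "fires_to G c d"
  shows "\<exists>k. sfires_to G s (\<lambda>v. (c(s := 0)) v + k * sink_config G s v) (d(s := 0))"
  using assms unfolding fires_to_def
proof (induction rule: rtranclp_induct)
  case base
  show ?case by (rule exI[of _ 0]) (simp add: sfires_to_def)
next
  case (step d e)
  then obtain k where k: "sfires_to G s (\<lambda>v. (c(s := 0)) v + k * sink_config G s v) (d(s := 0))"
    by blast
  obtain v where v: "v \<in> verts G" "out_degree G v \<le> d v" "e = fire G v d"
    using step by (auto simp: fire_step_def)
  show ?case
  proof (cases "v = s")
    case True
    \<comment> \<open>Each firing of \<open>s\<close> adds one copy of
      \<open>sink_config G s\<close>, which \<open>sfires_to_add\<close> moves to the start of the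
      run.\<close>
    have "e(s := 0) = (\<lambda>w. (d(s := 0)) w + sink_config G s w)"
      using True v by (auto simp: fun_eq_iff fire_def sink_config_def)
    moreover have "(\<lambda>w. (c(s := 0)) w + k * sink_config G s w + sink_config G s w) =
        (\<lambda>w. (c(s := 0)) w + Suc k * sink_config G s w)"
      by (simp add: algebra_simps)
    ultimately show ?thesis
      using sfires_to_add[OF k sink_config_in_sconfigs] by metis
  next
    case False
    have "e(s := 0) = (fire G v (d(s := 0)))(s := 0)"
      using False v by (auto simp: fun_eq_iff fire_def)
    then have "sfire_step G s (d(s := 0)) (e(s := 0))"
      using sfire_stepI[of v "d(s := 0)"] False v by simp
    then show ?thesis using k unfolding sfires_to_def
      by (meson rtranclp.rtrancl_into_rtrancl)
  qed
qed

lemma ex_push_if_fires_to: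
  assumes "x \<in> sconfigs G s" "y \<in> sconfigs G s" "sstable G s y" "fires_to G (x(s := m)) (y(s := n))"
  shows "\<exists>k. push k x = y"
proof -
  obtain k where "sfires_to G s (\<lambda>v. x v + k * sink_config G s v) y"
    using fires_to_project[OF assms(4)] sconfigs_upd assms(1,2) by auto
  then show ?thesis using stabilization_eqI assms(3) unfolding push_def by blast
qed

text \<open>Once the other vertices have relaxed to \<open>x\<close>, the sink can fire. Recurrence
  leads back, and projecting this round trip makes \<open>x\<close> periodic under
  \<open>push\<close>.\<close>

lemma ex_srecurrent_if_recurrent:
  assumes "c \<in> recurrents G"
  shows "\<exists>x\<in>srecurrents G s. \<exists>m. fires_to G c (x(s := m))"
proof -
  have c: "c(s := 0) \<in> sconfigs G s"
    using assms upd_in_sconfigs by (auto simp: recurrents_def)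
  define x where "x = stabilization G s (c(s := 0))"
  note x = stabilization_props[OF c, folded x_def]
  obtain m where m: "fires_to G c (x(s := m))"
    using sfires_to_lift[OF x(1), of "c s"] by auto
  then have rec: "x(s := m) \<in> recurrents G"
    using recurrents_closed assms by blast
  then obtain m' where "(fire_step G)\<^sup>+\<^sup>+ (x(s := m)) ((push 1 x)(s := m'))"
    using fire_sink out_degree_le_if_recurrent x by blast
  then have "fires_to G ((push 1 x)(s := m')) (x(s := m))"
    using rec by (simp add: recurrents_def fires_to_def tranclp_into_rtranclp)
  then obtain k where "push k (push 1 x) = x"
    using ex_push_if_fires_to push_props(3) x by blast
  then have "push (Suc k) x = x" using push_push x by simp
  then have "x \<in> srecurrents G s"
    using srecurrents_if_push_period x by blast
  then show ?thesis using m by blast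
qed

text \<open>The inverse tops up a member \<open>x\<close> of \<open>C\<close> with
  \<open>n - schips G s x\<close> chips on \<open>s\<close>; the result is recurrent as the d-level
  of \<open>C\<close> is at most \<open>n\<close>.\<close>

lemma bij_betw_rec_classes:
  "bij_betw (\<lambda>Q. {x \<in> srecurrents G s. \<exists>m. x(s := m) \<in> Q})
    (rec_classes G n) {C \<in> srec_classes G s. class_dlvl G s C \<le> n}"
  (is "bij_betw ?f ?A ?B")
proof -
  have recur: "c \<in> recurrents G" if "Q \<in> ?A" "c \<in> Q" for Q c
    using that equiv_rec_rel in_quotient_imp_subset unfolding rec_classes_def by blast
  have chips: "schips G s x + m = n" if "Q \<in> ?A" "x(s := m) \<in> Q" for Q x m
    using that level_eq_chips chips_upd by (auto simp: rec_classes_def)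
  \<comment> \<open>Runs inside \<open>Q\<close> project to pushes, and every push is realized by a
    run, so the image is a full class.\<close>
  have class_eq: "?f Q = srec_rel G s `` {x}"
    if Q: "Q \<in> ?A" and x: "x \<in> srecurrents G s" "x(s := m) \<in> Q" for Q x m
  proof -
    have Q': "Q \<in> recurrents G // rec_rel G" using Q by (simp add: rec_classes_def)
    have iff: "c \<in> Q \<longleftrightarrow> c \<in> recurrents G \<and> fires_to G (x(s := m)) c" for c
    proof -
      have "c \<in> Q \<longleftrightarrow> (x(s := m), c) \<in> rec_rel G"
        using in_quotient_imp_closed[OF equiv_rec_rel Q' x(2)]
          quotient_eq_iff[OF equiv_rec_rel Q' Q' x(2)] by blast
      then show ?thesis using recur[OF Q x(2)] by (simp add: rec_rel_def)
    qed
    show ?thesis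
    proof (intro equalityI subsetI)
      fix y assume "y \<in> ?f Q"
      then obtain m' where y: "y \<in> srecurrents G s" "fires_to G (x(s := m)) (y(s := m'))"
        using iff by blast
      then obtain k where "push k x = y"
        using ex_push_if_fires_to srecurrents_props x(1) by blast
      then show "y \<in> srec_rel G s `` {x}" using srec_rel_iff x(1) by auto
    next
      fix y assume "y \<in> srec_rel G s `` {x}"
      then obtain k where k: "y = push k x" using srec_rel_iff by auto
      have rec: "x(s := m) \<in> recurrents G" using recur Q x by blast
      then obtain m' where "fires_to G (x(s := m)) (y(s := m'))"
        using fires_to_push_if_recurrent x(1) k by blast
      then have "y(s := m') \<in> Q" using iff recurrents_closed rec by blast
      then show "y \<in> ?f Q" using push_in_srecurrents x(1) k by blast
    qed
  qed
  have rep: "\<exists>x\<in>srecurrents G s. \<exists>m. x(s := m) \<in> Q" if Q: "Q \<in> ?A" for Q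
  proof -
    have Q': "Q \<in> recurrents G // rec_rel G" using Q by (simp add: rec_classes_def)
    then obtain c where c: "c \<in> Q" using in_quotient_imp_non_empty[OF equiv_rec_rel] by blast
    then have c_rec: "c \<in> recurrents G" using recur Q by blast
    then obtain x m where x: "x \<in> srecurrents G s" "fires_to G c (x(s := m))"
      using ex_srecurrent_if_recurrent by blast
    then have "(c, x(s := m)) \<in> rec_rel G"
      using c_rec recurrents_closed by (simp add: rec_rel_def)
    then have "x(s := m) \<in> Q"
      using in_quotient_imp_closed[OF equiv_rec_rel Q' c] by blast
    then show ?thesis using x by blast
  qed
  show ?thesis
  proof (rule bij_betw_imageI)
    show "inj_on ?f ?A"
    proof (rule inj_onI)
      fix P Q assume PQ: "P \<in> ?A" "Q \<in> ?A" "?f P = ?f Q"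
      obtain x m where x: "x \<in> srecurrents G s" "x(s := m) \<in> P" using rep PQ by blast
      then obtain m' where m': "x(s := m') \<in> Q" using PQ(3) by blast
      \<comment> \<open>Both classes have level \<open>n\<close>, which fixes the count on
        \<open>s\<close>; hence they share a configuration.\<close>
      have "m' = m" using chips[OF PQ(1) x(2)] chips[OF PQ(2) m'] by simp
      then show "P = Q"
        using quotient_disj[OF equiv_rec_rel] PQ x m' unfolding rec_classes_def by blast
    qed
    show "?f ` ?A = ?B"
    proof (intro equalityI subsetI)
      fix C assume "C \<in> ?f ` ?A"
      then obtain Q where Q: "Q \<in> ?A" "C = ?f Q" by blast
      obtain x m where x: "x \<in> srecurrents G s" "x(s := m) \<in> Q" using rep Q by blast
      have "C = srec_rel G s `` {x}" using class_eq Q x by simp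
      then have C: "C \<in> srec_classes G s" "x \<in> C"
        using x equiv_class_self[OF equiv_srec_rel] by (auto simp: srec_classes_def quotientI)
      then have "class_dlvl G s C \<le> schips G s x + m"
        using upd_recurrent_iff_class_dlvl recur Q x by blast
      then show "C \<in> ?B" using C chips Q x by simp
    next
      fix C assume "C \<in> ?B"
      then have C: "C \<in> srec_classes G s" "class_dlvl G s C \<le> n" by auto
      then obtain x where x: "x \<in> C"
        using in_quotient_imp_non_empty[OF equiv_srec_rel] unfolding srec_classes_def by blast
      note x_rec = srec_class_eq_range[OF C(1) x]
      have "schips G s x \<le> n"
        using slvl_eq_class_dlvl[OF C(1) x] C(2) by (simp add: slvl_def)
      define m where "m = n - schips G s x"
      have m: "schips G s x + m = n" using \<open>schips G s x \<le> n\<close> by (simp add: m_def)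
      then have rec: "x(s := m) \<in> recurrents G"
        using upd_recurrent_iff_class_dlvl[OF C(1) x] C(2) by simp
      define Q where "Q = rec_rel G `` {x(s := m)}"
      have Q': "Q \<in> recurrents G // rec_rel G" "x(s := m) \<in> Q"
        using rec equiv_class_self[OF equiv_rec_rel] by (auto simp: Q_def quotientI)
      then have Q: "Q \<in> ?A"
        using level_eq_chips[OF Q'] m chips_upd by (simp add: rec_classes_def)
      have "?f Q = srec_rel G s `` {x}" using class_eq[OF Q x_rec(1) Q'(2)] .
      also have "\<dots> = C" using x_rec srec_rel_iff by auto
      finally show "C \<in> ?f ` ?A" using Q by blast
    qed
  qed
qed

section \<open>The identity of power series\<close>

lemma slvl_poly_eq_biggs_merino_poly: "slvl_poly G s = biggs_merino_poly G s"
  by (simp add: slvl_poly_def biggs_merino_poly_def class_slvl_eq_class_dlvl)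

text \<open>The coefficients of \<open>rec_series G\<close> count classes of d-level at most
  \<open>n\<close>; the factor \<open>1 - fps_X\<close> takes differences, leaving d-level exactly
  \<open>n\<close>.\<close>

lemma biggs_merino_poly_eq: "fps_of_poly (biggs_merino_poly G s) = (1 - fps_X) * rec_series G"
proof (rule fps_ext)
  fix n
  let ?B = "\<lambda>n. {C \<in> srec_classes G s. class_dlvl G s C \<le> n}"
  let ?E = "{C \<in> srec_classes G s. class_dlvl G s C = n}"
  have card: "card (rec_classes G m) = card (?B m)" for m
    using bij_betw_rec_classes bij_betw_same_card by blast
  have "fps_nth (fps_of_poly (biggs_merino_poly G s)) n = int (card ?E)"
  proof -
    have "fps_nth (fps_of_poly (biggs_merino_poly G s)) n =
        (\<Sum>C\<in>srec_classes G s. if class_dlvl G s C = n then 1 else 0)"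
      by (simp add: biggs_merino_poly_def coeff_sum)
    also have "\<dots> = int (card ?E)"
      using finite_srec_classes by (simp add: sum.If_cases Int_def)
    finally show ?thesis .
  qed
  also have "\<dots> = fps_nth ((1 - fps_X) * rec_series G) n"
  proof (cases n)
    case 0
    \<comment> \<open>No earlier coefficient is subtracted here, and d-level at most
      \<open>0\<close> means d-level \<open>0\<close>.\<close>
    then show ?thesis by (simp add: rec_series_def card left_diff_distrib)
  next
    case (Suc k)
    have "?B n = ?B k \<union> ?E" "?B k \<inter> ?E = {}" using Suc by auto
    then have "card (?B n) = card (?B k) + card ?E"
      using finite_srec_classes by (simp add: card_Un_disjoint)
    then show ?thesis using Suc by (simp add: rec_series_def card left_diff_distrib)
  qed
  finally show "fps_nth (fps_of_poly (biggs_merino_poly G s)) n = fps_nth ((1 - fps_X) * rec_series G) n" .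
qed

end

end

theorem theorem4p4:
  fixes G :: "('a, 'b) pre_digraph"
  assumes "fin_digraph G"
    and "strongly_connected G"
  shows "(\<forall>s\<in>verts G.
            fps_of_poly (biggs_merino_poly G s) = fps_of_poly (slvl_poly G s) \<and>
            fps_of_poly (slvl_poly G s) = (1 - fps_X) * rec_series G) \<and>
         (\<forall>s\<in>verts G. \<forall>t\<in>verts G. biggs_merino_poly G s = biggs_merino_poly G t)"
proof -
  interpret strong_digraph G
    using assms by (simp add: strong_digraph_def strong_digraph_axioms_def)
  \<comment> \<open>A polynomial is determined by its power series, and
    \<open>(1 - fps_X) * rec_series G\<close> does not mention the sink.\<close>
  have indep: "biggs_merino_poly G s = biggs_merino_poly G t" if "s \<in> verts G" "t \<in> verts G" for s t
  proof -
    have "fps_of_poly (biggs_merino_poly G s) = fps_of_poly (biggs_merino_poly G t)"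
      using that by (simp only: biggs_merino_poly_eq)
    then show ?thesis by (simp only: fps_of_poly_eq_iff)
  qed
  show ?thesis
    by (intro conjI ballI indep) (simp_all only: slvl_poly_eq_biggs_merino_poly biggs_merino_poly_eq)
qed

end
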